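(* Let $g(z)=\sum_{n=0}^\infty a_nz^n$ be analytic for $|z|<1$, let $(d_k)_{k\geqslant1}$ be real numbers with $0<d^-\leqslant d_k\leqslant d^+$ for all $k\geqslant 1$, where $d^-,d^+$ are fixed positive constants, and let the positive numbers $p_j$ be defined by $$p(z)=\sum_{j=0}^\infty p_jz^j=\exp\Bigl\{\sum_{k=1}^\infty\frac{d_k}{k}z^k\Bigr\}.$$ Let $A\in\mathbb{C}$. Then the relation $$\lim_{n\to\infty}\frac{1}{p_n}\sum_{k=0}^na_kp_{n-k}=A$$ holds if and only if the following two conditions are satisfied: 1. $\displaystyle\lim_{x\uparrow1}g(x)=A$; 2. $\displaystyle\sum_{k=0}^na_k\,k\,p_{n-k}=o(np_n)$ as $n\to\infty$.
   Context: The coefficients $a_n$ are complex numbers. In condition 1, $x$ tends to $1$ through real values $x<1$. *)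

theory Defs
  imports "HOL-Complex_Analysis.Complex_Analysis" "HOL-Library.Landau_Symbols"
begin

end

theory Submission
  imports Defs
begin

text \<open>
  Put \<open>S n = (\<Sum>k\<le>n. a k * p (n - k)) - A * p n\<close> and \<open>T n = (\<Sum>k\<le>n. a k * k * p (n - k))\<close>; the claim is that
  \<open>S n / p n\<close> tends to 0 iff \<open>g x - A\<close> does as \<open>x\<close> increases to 1 and \<open>T n / (n * p n)\<close> does.  Applying
  \<open>z * d/dz\<close> to \<open>p(z)\<close> and to \<open>(g(z) - A) * p(z)\<close> gives the two recurrences that carry the proof,

  \<open>n * p n = (\<Sum>m<n. d (n - m) * p m)\<close> and \<open>n * S n = T n + (\<Sum>m<n. d (n - m) * S m)\<close>.

  Hence \<open>S n / p n\<close> equals \<open>T n / (n * p n)\<close> plus an average of the earlier values \<open>S m / p m\<close>, with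
  weights \<open>d (n - m) * p m / (n * p n)\<close> that sum to 1.  On the other hand
  \<open>g x - A = (\<Sum>m. S m * x ^ m) / (\<Sum>m. p m * x ^ m)\<close> is also an average of the same values.

  If \<open>S n / p n\<close> tends to 0, then so do both averages, because the weight of each initial segment tends
  to 0; that is the direct half (\<open>abelian_G\<close>, \<open>abelian_T\<close>).

  For the converse, the weights of the first average are bounded below by those of the second, up to
  a constant factor: \<open>d (n - m) \<ge> dm \<ge> dm * x ^ m\<close>, where \<open>dm\<close> is the lower bound of the \<open>d k\<close>.
  Therefore \<open>dm * (\<Sum>m. S m * x ^ m)\<close>, which is small by hypothesis, can be subtracted from the
  recurrence, and this removes a fixed proportion of the total weight.  The price is the tail
  \<open>m \<ge> n\<close> of the second average; with \<open>x = 1 - 4 * dp / n\<close>, where \<open>dp\<close> is the upper bound of the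
  \<open>d k\<close>, it has at most a quarter of the mass, by Markov's inequality and the bound
  \<open>dp / (1 - x)\<close> for its mean.  The result is \<open>contraction\<close>: up to small terms,
  \<open>norm (S n) / p n\<close> is at most \<open>1 - gain\<close> times any bound for all the ratios \<open>norm (S m) / p m\<close>.

  It remains to know that these ratios are bounded.  The recurrence alone allows only slow growth: the
  weighted mean of \<open>m\<close> is at most a fixed proportion of \<open>n\<close> (\<open>drift\<close>), so the ratio at \<open>m > n\<close>
  exceeds the maximum over \<open>{..n}\<close> by at most \<open>K * m / n\<close> (\<open>growth\<close>).  That extra term has bounded
  average, so \<open>contraction\<close> applied at an index where the ratio takes its largest value so far bounds
  that value (\<open>bounded_ratio\<close>).  Iterating \<open>contraction\<close> then drives the upper limit to 0
  (\<open>tauberian\<close>).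
\<close>

section \<open>Recurrences from logarithmic derivatives\<close>

text \<open>
  A coefficient recurrence with an inhomogeneous term \<open>Y\<close>: it is used with \<open>Y = 0\<close> for \<open>p(z)\<close>
  itself and with \<open>Y = z * g'(z) * p(z)\<close> for the product \<open>(g(z) - A) * p(z)\<close>, whose last factor
  contributes the same logarithmic derivative.
\<close>
lemma fps_euler_operator_nth:
  fixes X Y :: "'a :: comm_ring_1 fps"
  assumes "fps_X * fps_deriv X = Y + X * Abs_fps (\<lambda>k. if k = 0 then 0 else c k)"
  shows "of_nat n * fps_nth X n = fps_nth Y n + (\<Sum>m<n. c (n - m) * fps_nth X m)"
proof -
  have "of_nat n * fps_nth X n = fps_nth (fps_X * fps_deriv X) n"
    by (cases n) auto
  also have "\<dots> = fps_nth Y n + (\<Sum>m\<le>n. fps_nth X m * (if n - m = 0 then 0 else c (n - m)))"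
    by (simp add: assms fps_mult_nth atMost_atLeast0)
  also have "(\<Sum>m\<le>n. fps_nth X m * (if n - m = 0 then 0 else c (n - m)))
      = (\<Sum>m<n. c (n - m) * fps_nth X m)"
    by (simp add: lessThan_Suc_atMost[symmetric] mult.commute)
  finally show ?thesis .
qed

text \<open>
  The identity \<open>z * p'(z) = p(z) * (\<Sum>k\<ge>1. c k * z ^ k)\<close>, transferred from functions on the unit disc to
  formal power series, so that all later recurrences become algebra of formal series.
\<close>
lemma exp_series_euler:
  fixes c f :: "nat \<Rightarrow> complex"
  assumes c: "\<And>k. norm (c k) \<le> D"
    and f: "\<And>z. norm z < 1 \<Longrightarrow> (\<lambda>j. f j * z ^ j) sums exp (\<Sum>k. c (Suc k) / of_nat (Suc k) * z ^ Suc k)"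
  shows "fps_X * fps_deriv (Abs_fps f) = Abs_fps f * Abs_fps (\<lambda>k. if k = 0 then 0 else c k)"
proof -
  define L where "L = Abs_fps (\<lambda>k. if k = 0 then 0 else c k / of_nat k)"
  have L_summable: "summable (\<lambda>k. fps_nth L k * z ^ k)" if "norm z < 1" for z
  proof (rule summable_comparison_test'[where N = 0])
    show "summable (\<lambda>k. D * norm z ^ k)"
      using that by (intro summable_mult summable_geometric) simp
    fix k :: nat
    have "norm (fps_nth L k) \<le> D"
    proof (cases "k = 0")
      case False
      then have "norm (c k) / real k \<le> norm (c k)"
        by (simp add: divide_le_eq mult_le_cancel_left1)
      with c[of k] False show ?thesis by (simp add: L_def norm_divide)
    qed (use order_trans[OF norm_ge_zero c] in \<open>simp add: L_def\<close>)
    then show "norm (fps_nth L k * z ^ k) \<le> D * norm z ^ k"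
      by (simp add: norm_mult norm_power mult_right_mono)
  qed
  have radius: "1 \<le> fps_conv_radius L" "1 \<le> fps_conv_radius (Abs_fps f)"
    unfolding fps_conv_radius_def
    by (auto intro!: conv_radius_geI_ex' L_summable sums_summable[OF f] simp: one_ereal_def)
  have inside: "ereal (norm z) < fps_conv_radius L" "ereal (norm z) < fps_conv_radius (Abs_fps f)"
    if "norm z < 1" for z :: complex
    using that radius by (metis ereal_less(3) less_le_trans ereal_less_eq)+
  have eq: "eval_fps (Abs_fps f) z = exp (eval_fps L z)" if "norm z < 1" for z
  proof -
    have "eval_fps L z = (\<Sum>k. fps_nth L (Suc k) * z ^ Suc k)"
      unfolding eval_fps_def using suminf_split_head[OF L_summable[OF that]] by (simp add: L_def)
    then show ?thesis
      using sums_unique[OF f[OF that]] by (simp add: eval_fps_def L_def)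
  qed
  have deriv: "eval_fps (fps_deriv (Abs_fps f)) z = eval_fps (Abs_fps f * fps_deriv L) z"
    if "norm z < 1" for z
  proof -
    have "((\<lambda>z. exp (eval_fps L z)) has_field_derivative
        exp (eval_fps L z) * eval_fps (fps_deriv L) z) (at z)"
      by (rule derivative_eq_intros has_field_derivative_eval_fps inside that refl)+
    then have "(eval_fps (Abs_fps f) has_field_derivative
        exp (eval_fps L z) * eval_fps (fps_deriv L) z) (at z)"
      by (rule has_field_derivative_transform_within_open[of _ _ _ "ball 0 1"])
        (use that eq in auto)
    from DERIV_unique[OF has_field_derivative_eval_fps[OF inside(2)[OF that]] this]
    show ?thesis
      using inside[OF that] fps_conv_radius_deriv[of L]
      by (subst eval_fps_mult) (auto simp: eq[OF that] intro: less_le_trans)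
  qed
  have "fps_deriv (Abs_fps f) = Abs_fps f * fps_deriv L"
  proof (rule eval_fps_eqD)
    show "0 < fps_conv_radius (fps_deriv (Abs_fps f))"
      using inside(2)[of 0] fps_conv_radius_deriv[of "Abs_fps f"]
      by (auto simp: zero_ereal_def intro: less_le_trans)
    have "0 < min (fps_conv_radius (Abs_fps f)) (fps_conv_radius (fps_deriv L))"
      using inside[of 0] fps_conv_radius_deriv[of L]
      by (auto simp: zero_ereal_def intro: less_le_trans)
    then show "0 < fps_conv_radius (Abs_fps f * fps_deriv L)"
      using fps_conv_radius_mult by (rule less_le_trans)
    have "\<forall>\<^sub>F z in nhds 0. z \<in> ball (0::complex) 1"
      by (rule eventually_nhds_in_open) auto
    then show "\<forall>\<^sub>F z in nhds 0. eval_fps (fps_deriv (Abs_fps f)) z = eval_fps (Abs_fps f * fps_deriv L) z"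
      by eventually_elim (use deriv in simp)
  qed
  moreover have "fps_X * fps_deriv L = Abs_fps (\<lambda>k. if k = 0 then 0 else c k)"
  proof (rule fps_ext)
    show "fps_nth (fps_X * fps_deriv L) n = fps_nth (Abs_fps (\<lambda>k. if k = 0 then 0 else c k)) n" for n
      by (cases n) (simp_all add: L_def field_simps del: of_nat_Suc)
  qed
  ultimately show ?thesis by (simp add: mult_ac)
qed

section \<open>Mass and moments of the weights\<close>

text \<open>
  The recurrence \<open>p_rec\<close> says that the logarithmic derivative of \<open>\<Sum>n. p n * x ^ n\<close> is
  \<open>\<Sum>k. d (k + 1) * x ^ k\<close>; the bounds \<open>dm\<close> and \<open>dp\<close> compare that series with the geometric one.
\<close>
locale bounded_log_derivative =
  fixes d p :: "nat \<Rightarrow> real" and dm dp :: real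
  assumes dm_pos: "0 < dm"
    and d_bounds: "\<And>k. k \<ge> 1 \<Longrightarrow> dm \<le> d k \<and> d k \<le> dp"
    and p_0: "p 0 = 1"
    and p_rec: "\<And>n. real n * p n = (\<Sum>m<n. d (n - m) * p m)"
    and p_summable: "\<And>x. 0 \<le> x \<Longrightarrow> x < 1 \<Longrightarrow> summable (\<lambda>n. p n * x ^ n)"
begin

definition mass :: "nat \<Rightarrow> real" where "mass n = (\<Sum>m<n. p m)"

definition gf :: "real \<Rightarrow> real" where "gf x = (\<Sum>n. p n * x ^ n)"

lemma dp_pos: "0 < dp"
  using dm_pos d_bounds[of 1] by simp

lemma d_lower: "m < n \<Longrightarrow> dm \<le> d (n - m)"
  and d_upper: "m < n \<Longrightarrow> d (n - m) \<le> dp"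
  using d_bounds[of "n - m"] by auto

lemma d_pos: "m < n \<Longrightarrow> 0 < d (n - m)"
  using d_lower dm_pos by force

lemma p_pos: "0 < p n"
proof (induction n rule: less_induct)
  case (less n)
  show ?case
  proof (cases "n = 0")
    case False
    have "0 < real n * p n"
      unfolding p_rec using False less d_pos by (intro sum_pos) auto
    then show ?thesis
      by (simp add: zero_less_mult_iff)
  qed (simp add: p_0)
qed

lemma p_nonneg [simp]: "0 \<le> p n"
  using p_pos by (rule less_imp_le)

text \<open>
  The form in which the bounds on \<open>d\<close> give regularity of \<open>p\<close>: the value at \<open>n\<close>, times \<open>n\<close>, is
  comparable to the mass below \<open>n\<close>.  Every later estimate on \<open>p\<close> rests on this.
\<close>
lemma mass_le_np: "dm * mass n \<le> real n * p n"
  unfolding p_rec mass_def sum_distrib_left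
  by (intro sum_mono mult_right_mono d_lower) auto

lemma np_le_mass: "real n * p n \<le> dp * mass n"
  unfolding p_rec mass_def sum_distrib_left
  by (intro sum_mono mult_right_mono d_upper) auto

lemma mass_nonneg: "0 \<le> mass n"
  unfolding mass_def by (intro sum_nonneg p_nonneg)

lemma mass_ge_1: "n \<ge> 1 \<Longrightarrow> 1 \<le> mass n"
proof -
  assume "n \<ge> 1"
  have "p 0 \<le> (\<Sum>m<n. p m)"
    by (rule member_le_sum) (use \<open>n \<ge> 1\<close> in auto)
  then show ?thesis by (simp add: mass_def p_0)
qed

lemma mass_at_top: "filterlim mass at_top sequentially"
proof -
  have step: "dm / real (Suc n) \<le> p (Suc n)" for n
  proof -
    have "dm * 1 \<le> dm * mass (Suc n)"
      using mass_ge_1[of "Suc n"] dm_pos by (intro mult_left_mono) auto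
    also note mass_le_np
    finally show ?thesis by (simp add: divide_le_eq mult.commute)
  qed
  have "dm * harm n \<le> mass (Suc n)" for n
  proof (induction n)
    case 0
    then show ?case using mass_nonneg by (simp add: harm_def)
  next
    case (Suc n)
    have "mass (Suc (Suc n)) = mass (Suc n) + p (Suc n)" by (simp add: mass_def)
    then show ?case using Suc step[of n]
      by (simp add: harm_Suc algebra_simps divide_inverse)
  qed
  moreover have "filterlim (\<lambda>n. dm * harm n) at_top sequentially"
    by (rule filterlim_tendsto_pos_mult_at_top[OF tendsto_const dm_pos harm_at_top])
  ultimately have "filterlim (\<lambda>n. mass (Suc n)) at_top sequentially"
    by (auto intro: filterlim_at_top_mono always_eventually)
  then show ?thesis by (simp add: filterlim_sequentially_Suc)
qed

lemma np_at_top: "filterlim (\<lambda>n. real n * p n) at_top sequentially"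
proof (rule filterlim_at_top_mono)
  show "filterlim (\<lambda>n. dm * mass n) at_top sequentially"
    by (rule filterlim_tendsto_pos_mult_at_top[OF tendsto_const dm_pos mass_at_top])
qed (simp add: mass_le_np)

lemma const_over_np: "(\<lambda>n. C / (real n * p n)) \<longlonglongrightarrow> 0"
  by (rule real_tendsto_divide_at_top[OF tendsto_const np_at_top])

text \<open>
  Divided by \<open>n * p n\<close>, the sum on the right is the mean distance \<open>n - m\<close> under the weights
  \<open>d (n - m) * p m / (n * p n)\<close>, so that mean is at least a fixed proportion of \<open>n\<close>.  The
  reason is that \<open>m * p m\<close> is at most \<open>dp\<close> times the mass below \<open>m\<close>, which prevents \<open>p\<close>
  from concentrating near \<open>n\<close>.
\<close>
lemma drift:
  "dm * (real n * (real n * p n)) \<le> dp * (1 + dp) * (\<Sum>m<n. d (n - m) * p m * real (n - m))"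
proof -
  define Q where "Q n = (\<Sum>m<n. p m * real (n - m))" for n
  have Q_Suc: "Q (Suc n) = Q n + mass (Suc n)" for n
  proof -
    have "Q (Suc n) = (\<Sum>m<Suc n. p m * real (n - m) + p m)"
      unfolding Q_def by (intro sum.cong) (auto simp: of_nat_diff algebra_simps)
    then show ?thesis by (simp add: sum.distrib Q_def mass_def)
  qed
  have Q_ge: "real n * mass n \<le> (1 + dp) * Q n" for n
  proof (induction n)
    case (Suc n)
    have "real (Suc n) * mass (Suc n) = real n * mass n + real n * p n + mass (Suc n)"
      by (simp add: mass_def algebra_simps)
    also have "\<dots> \<le> (1 + dp) * Q n + dp * mass n + mass (Suc n)"
      using Suc np_le_mass[of n] by simp
    also have "\<dots> \<le> (1 + dp) * Q n + dp * mass (Suc n) + mass (Suc n)"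
      using dp_pos p_pos[of n] by (simp add: mass_def)
    also have "\<dots> = (1 + dp) * Q (Suc n)"
      by (simp add: Q_Suc algebra_simps)
    finally show ?case .
  qed (simp add: Q_def mass_def)
  have "real n * (real n * p n) \<le> real n * (dp * mass n)"
    using np_le_mass by (rule mult_left_mono) simp
  also have "\<dots> \<le> dp * ((1 + dp) * Q n)"
    using mult_left_mono[OF Q_ge[of n], of dp] dp_pos by (simp add: mult_ac)
  finally have "dm * (real n * (real n * p n)) \<le> dm * (dp * ((1 + dp) * Q n))"
    using dm_pos by simp
  also have "\<dots> = dp * (1 + dp) * (dm * Q n)" by (simp add: mult_ac)
  also have "dm * Q n \<le> (\<Sum>m<n. d (n - m) * p m * real (n - m))"
    unfolding Q_def sum_distrib_left
    by (intro sum_mono) (auto simp: mult.assoc intro!: mult_right_mono d_lower mult_nonneg_nonneg)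
  finally show ?thesis using dp_pos by simp
qed

lemma gf_ge_partial: "0 \<le> x \<Longrightarrow> x < 1 \<Longrightarrow> x ^ n * mass n \<le> gf x"
proof -
  assume x: "0 \<le> x" "x < 1"
  have "x ^ n * mass n \<le> (\<Sum>m<n. p m * x ^ m)"
    unfolding mass_def sum_distrib_left
    by (intro sum_mono)
      (use x in \<open>auto simp: mult.commute intro!: mult_left_mono power_decreasing\<close>)
  also have "\<dots> \<le> gf x"
    unfolding gf_def by (rule sum_le_suminf)
      (use x p_summable in auto)
  finally show ?thesis .
qed

lemma gf_pos: "0 \<le> x \<Longrightarrow> x < 1 \<Longrightarrow> 0 < gf x"
  unfolding gf_def using p_summable[of x] by (intro suminf_pos2[where i = 0]) (auto simp: p_0)

lemma gf_at_top: "filterlim gf at_top (at_left 1)"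
  unfolding filterlim_at_top
proof
  fix Z :: real
  obtain n where n: "mass n > Z"
    using mass_at_top by (metis eventually_happens filterlim_at_top_dense trivial_limit_sequentially)
  have "((\<lambda>x. x ^ n * mass n) \<longlongrightarrow> 1 ^ n * mass n) (at_left 1)"
    by (intro tendsto_intros)
  then have "\<forall>\<^sub>F x in at_left 1. Z < x ^ n * mass n"
    by (rule order_tendstoD) (use n in simp)
  moreover have "\<forall>\<^sub>F x in at_left (1::real). x \<in> {0<..<1}"
    by (rule eventually_at_left_real) simp
  ultimately show "\<forall>\<^sub>F x in at_left 1. Z \<le> gf x"
  proof eventually_elim
    case (elim x)
    then show ?case using gf_ge_partial[of x n] by simp
  qed
qed

text \<open>
  The moment series is \<open>x\<close> times the derivative of \<open>gf\<close>, that is \<open>gf x\<close> times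
  \<open>\<Sum>k\<ge>1. d k * x ^ k\<close>, and the last factor is dominated by a geometric series.
\<close>
lemma gf_first_moment:
  assumes x: "0 \<le> x" "x < 1"
  shows "summable (\<lambda>n. real n * p n * x ^ n)"
    and "(\<Sum>n. real n * p n * x ^ n) \<le> dp / (1 - x) * gf x"
proof -
  define e where "e k = (if k = 0 then 0 else d k * x ^ k)" for k
  have "0 \<le> e k \<and> e k \<le> dp * x ^ k" for k
  proof (cases "k = 0")
    case False
    then have "0 \<le> d k" "d k \<le> dp" using d_bounds[of k] dm_pos by auto
    then show ?thesis using False x by (simp add: e_def mult_right_mono)
  qed (use dp_pos in \<open>simp add: e_def\<close>)
  then have e: "0 \<le> e k" "e k \<le> dp * x ^ k" for k by auto
  have geo: "summable (\<lambda>k. dp * x ^ k)"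
    using x by (intro summable_mult summable_geometric) simp
  have e_summable: "summable e"
    by (rule summable_comparison_test'[OF geo, of 0]) (use e in auto)
  have "suminf e \<le> (\<Sum>k. dp * x ^ k)"
    by (rule suminf_le[OF e(2) e_summable geo])
  also have "\<dots> = dp / (1 - x)"
    using x by (subst suminf_mult) (auto simp: suminf_geometric)
  finally have e_sum: "suminf e \<le> dp / (1 - x)" .
  have "(\<lambda>n. \<Sum>m\<le>n. (p m * x ^ m) * e (n - m)) sums (gf x * suminf e)"
    unfolding gf_def
  proof (rule Cauchy_product_sums)
    show "summable (\<lambda>k. norm (p k * x ^ k))"
      using p_summable[OF x] x by (simp add: abs_mult)
    show "summable (\<lambda>k. norm (e k))"
      using e_summable e(1) by simp
  qed
  moreover have "(\<Sum>m\<le>n. (p m * x ^ m) * e (n - m)) = real n * p n * x ^ n" for n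
  proof -
    have "(\<Sum>m\<le>n. (p m * x ^ m) * e (n - m)) = (\<Sum>m<n. (p m * x ^ m) * e (n - m))"
      by (simp add: lessThan_Suc_atMost[symmetric] e_def)
    also have "\<dots> = (\<Sum>m<n. d (n - m) * p m * x ^ n)"
    proof (rule sum.cong)
      fix m assume "m \<in> {..<n}"
      then have "x ^ n = x ^ m * x ^ (n - m)" "n - m \<noteq> 0"
        by (simp_all flip: power_add)
      then show "(p m * x ^ m) * e (n - m) = d (n - m) * p m * x ^ n"
        by (simp add: e_def)
    qed simp
    finally show ?thesis by (simp add: p_rec sum_distrib_right)
  qed
  ultimately have sums: "(\<lambda>n. real n * p n * x ^ n) sums (gf x * suminf e)" by simp
  then show "summable (\<lambda>n. real n * p n * x ^ n)" by (rule sums_summable)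
  show "(\<Sum>n. real n * p n * x ^ n) \<le> dp / (1 - x) * gf x"
    using sums_unique[OF sums] mult_left_mono[OF e_sum, of "gf x"] gf_pos[OF x]
    by (simp add: mult.commute)
qed

text \<open>
  The point at which \<open>gf\<close> is compared with the recurrence at \<open>n\<close>.  The factor 4 makes the mean of
  \<open>m\<close> under the weights \<open>p m * x ^ m / gf x\<close> at most \<open>n / 4\<close>, so that at most a quarter of the mass lies
  beyond \<open>n\<close>; the requirement \<open>8 * dp \<le> n\<close> in the sequel keeps the point in \<open>{1/2..<1}\<close>.
\<close>
definition radius :: "nat \<Rightarrow> real" where "radius n = 1 - 4 * dp / real n"

lemma radius_bounds:
  assumes "8 * dp \<le> real n"
  shows "1 / 2 \<le> radius n" "radius n < 1"
proof -
  have "0 < real n" using assms dp_pos by linarith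
  then show "1 / 2 \<le> radius n" "radius n < 1"
    using assms dp_pos by (simp_all add: radius_def field_simps)
qed

lemma radius_at_left: "filterlim radius (at_left 1) sequentially"
proof -
  have "radius \<longlonglongrightarrow> 1 - 0"
    unfolding radius_def by (intro tendsto_intros real_tendsto_divide_at_top filterlim_real_sequentially)
  moreover have "eventually (\<lambda>n. radius n < 1) sequentially"
    using eventually_gt_at_top[of "0::nat"] by eventually_elim (use dp_pos in \<open>simp add: radius_def\<close>)
  ultimately show ?thesis
    by (auto simp: filterlim_at elim: eventually_mono)
qed

lemma moment_at_radius:
  assumes "8 * dp \<le> real n"
  shows "(\<Sum>m. real m * p m * radius n ^ m) \<le> real n / 4 * gf (radius n)"
proof -
  have "dp / (1 - radius n) = real n / 4" using assms dp_pos by (simp add: radius_def)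
  moreover have "0 \<le> radius n" "radius n < 1" using radius_bounds[OF assms] by auto
  ultimately show ?thesis using gf_first_moment(2)[of "radius n"] by metis
qed

text \<open>Markov's inequality for the mean in \<open>moment_at_radius\<close>.\<close>
lemma tail_at_radius:
  assumes n: "8 * dp \<le> real n"
  shows "(\<Sum>m. p (m + n) * radius n ^ (m + n)) \<le> gf (radius n) / 4"
proof -
  have npos: "0 < real n" using n dp_pos by linarith
  have x: "0 \<le> radius n" "radius n < 1" using radius_bounds[OF n] by auto
  note sm = gf_first_moment(1)[OF x]
  have "real n * (\<Sum>m. p (m + n) * radius n ^ (m + n)) = (\<Sum>m. real n * (p (m + n) * radius n ^ (m + n)))"
    by (rule suminf_mult[symmetric]) (use summable_ignore_initial_segment[OF p_summable[OF x]] in simp)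
  also have "\<dots> \<le> (\<Sum>m. real (m + n) * p (m + n) * radius n ^ (m + n))"
    by (intro suminf_le summable_mult summable_ignore_initial_segment[OF p_summable[OF x]]
        summable_ignore_initial_segment[OF sm])
      (use x in \<open>auto simp: mult.assoc intro!: mult_right_mono\<close>)
  also have "\<dots> \<le> (\<Sum>m. real m * p m * radius n ^ m)"
    using suminf_split_initial_segment[OF sm, of n] x
    by (simp add: sum_nonneg)
  also note moment_at_radius[OF n]
  finally have "real n * (\<Sum>m. p (m + n) * radius n ^ (m + n)) \<le> real n * (gf (radius n) / 4)" by simp
  then show ?thesis using npos by simp
qed

lemma gf_upper:
  assumes n: "8 * dp \<le> real n"
  shows "dm * gf (radius n) \<le> 2 * (real n * p n)"
proof -
  have x: "0 \<le> radius n" "radius n < 1" using radius_bounds[OF n] by auto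
  have "gf (radius n) = (\<Sum>m. p (m + n) * radius n ^ (m + n)) + (\<Sum>m<n. p m * radius n ^ m)"
    unfolding gf_def by (rule suminf_split_initial_segment[OF p_summable[OF x]])
  also have "(\<Sum>m<n. p m * radius n ^ m) \<le> mass n"
    unfolding mass_def using x by (intro sum_mono mult_left_le power_le_one) auto
  finally have "gf (radius n) \<le> 2 * mass n" using tail_at_radius[OF n] mass_nonneg[of n] gf_pos[OF x] by linarith
  then have "dm * gf (radius n) \<le> 2 * (dm * mass n)" using dm_pos by simp
  then show ?thesis using mass_le_np[of n] by linarith
qed

text \<open>
  A lower bound, uniform in \<open>n\<close>, for the net proportion of weight that is removed when
  \<open>dm * (\<Sum>m. S m * x ^ m)\<close> is subtracted from the recurrence at \<open>x = radius n\<close>; the exponential bounds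
  \<open>radius n ^ n\<close> from below.
\<close>
definition gain :: real where "gain = dm * exp (- 8 * dp) / (2 * dp)"

lemma gain_pos: "0 < gain"
  using dm_pos dp_pos by (simp add: gain_def)

lemma gf_lower:
  assumes n: "8 * dp \<le> real n"
  shows "gain * (real n * p n) \<le> dm * gf (radius n) / 2"
proof -
  have x: "0 \<le> radius n" "radius n < 1" using radius_bounds[OF n] by auto
  have npos: "0 < real n" using n dp_pos by linarith
  define t where "t = 4 * dp / real n"
  have t: "0 \<le> t" "t \<le> 1 / 2" using n npos dp_pos by (auto simp: t_def field_simps)
  have "exp (- (2 * t)) \<le> 1 - t"
  proof -
    have "1 \<le> (1 - t) * (1 + 2 * t)"
      using t mult_nonneg_nonneg[of t "1 - 2 * t"] by (simp add: algebra_simps)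
    also have "\<dots> \<le> (1 - t) * exp (2 * t)"
      using t by (intro mult_left_mono exp_ge_add_one_self) auto
    finally show ?thesis by (simp add: exp_minus field_simps)
  qed
  then have "exp (- (2 * t)) ^ n \<le> radius n ^ n"
    by (intro power_mono) (auto simp: radius_def t_def)
  moreover have "exp (- (2 * t)) ^ n = exp (- 8 * dp)"
    using npos by (simp add: t_def flip: exp_of_nat_mult)
  ultimately have "exp (- 8 * dp) * (real n * p n) \<le> radius n ^ n * (dp * mass n)"
    using x by (intro mult_mono np_le_mass) auto
  also have "\<dots> \<le> dp * gf (radius n)"
    using mult_left_mono[OF gf_ge_partial[OF x, of n], of dp] dp_pos by (simp add: mult_ac)
  finally have "(dm / (2 * dp)) * (exp (- 8 * dp) * (real n * p n)) \<le> (dm / (2 * dp)) * (dp * gf (radius n))"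
    using dm_pos dp_pos by (intro mult_left_mono) auto
  then show ?thesis using dp_pos by (simp add: gain_def)
qed

end

section \<open>Averages along the recurrence\<close>

text \<open>
  Here \<open>G x\<close> is the mean of the ratios \<open>S m / p m\<close> under the weights \<open>p m * x ^ m / gf x\<close>.
\<close>
locale weighted_recurrence = bounded_log_derivative d p dm dp
  for d p :: "nat \<Rightarrow> real" and dm dp :: real +
  fixes S T :: "nat \<Rightarrow> complex" and G :: "real \<Rightarrow> complex"
  assumes S_rec: "\<And>n. of_nat n * S n = T n + (\<Sum>m<n. of_real (d (n - m)) * S m)"
    and S_sums: "\<And>x. 0 \<le> x \<Longrightarrow> x < 1 \<Longrightarrow> (\<lambda>n. S n * of_real x ^ n) sums (G x * of_real (gf x))"
begin

text \<open>
  The function \<open>M + K * m / n\<close> is a supersolution of the recurrence for \<open>norm (S m) / p m\<close> at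
  \<open>m > n\<close>: averaging lowers it by at least the proportion of \<open>K * m / n\<close> given by \<open>drift\<close>, and
  \<open>K\<close> is chosen so that this loss pays for the inhomogeneous term \<open>e\<close>.
\<close>
lemma growth:
  assumes n: "n \<ge> 1" and e: "\<And>m. norm (T m) \<le> e * (real m * p m)"
    and M: "\<And>m. m \<le> n \<Longrightarrow> norm (S m) \<le> M * p m"
    and K: "K = e * (dp * (1 + dp) / dm)"
  shows "norm (S m) \<le> p m * (M + K * (real m / real n))"
proof -
  have "0 \<le> norm (T 1)" by simp
  also have "\<dots> \<le> e * p 1" using e[of 1] by simp
  finally have e_nonneg: "0 \<le> e" using p_pos[of 1] by (simp add: zero_le_mult_iff)
  then have K_nonneg: "0 \<le> K" using K dm_pos dp_pos by simp
  show ?thesis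
  proof (induction m rule: less_induct)
    case (less m)
    show ?case
    proof (cases "m \<le> n")
      case True
      have "p m * M \<le> p m * (M + K * (real m / real n))"
        using K_nonneg by (intro mult_left_mono) auto
      then show ?thesis using M[OF True] by (simp add: mult.commute)
    next
      case False
      have mpos: "0 < real m" "real n \<le> real m" using False by auto
      have npos: "0 < real n" using n by simp
      define X where "X = (\<Sum>l<m. d (m - l) * p l * real (m - l))"
      have X: "e * (real m * (real m * p m)) \<le> K * X"
      proof -
        have "(e / dm) * (dm * (real m * (real m * p m))) \<le> (e / dm) * (dp * (1 + dp) * X)"
          unfolding X_def using e_nonneg dm_pos by (intro mult_left_mono drift) auto
        then show ?thesis using K dm_pos by (simp add: mult_ac)
      qed
      have "real m * norm (S m) = norm (T m + (\<Sum>l<m. of_real (d (m - l)) * S l))"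
        using S_rec[of m] by (metis norm_mult norm_of_nat)
      also have "\<dots> \<le> norm (T m) + (\<Sum>l<m. norm (of_real (d (m - l)) * S l))"
        by (intro order_trans[OF norm_triangle_ineq] add_left_mono norm_sum)
      also have "\<dots> \<le> e * (real m * p m) + (\<Sum>l<m. d (m - l) * (p l * (M + K * (real l / real n))))"
        using less d_pos by (intro add_mono e sum_mono) (auto simp: norm_mult less_imp_le intro!: mult_left_mono)
      also have "(\<Sum>l<m. d (m - l) * (p l * (M + K * (real l / real n))))
          = (\<Sum>l<m. (M + K * (real m / real n)) * (d (m - l) * p l)
                - (K / real n) * (d (m - l) * p l * real (m - l)))"
        using npos by (intro sum.cong) (auto simp: of_nat_diff field_simps)
      also have "\<dots> = (M + K * (real m / real n)) * (real m * p m) - (K / real n) * X"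
        by (simp only: sum_subtractf X_def p_rec sum_distrib_left)
      also have "e * (real m * p m) \<le> (K / real n) * X"
      proof -
        have "e * (real m * p m) * real n \<le> e * (real m * p m) * real m"
          using e_nonneg mpos by (intro mult_left_mono) auto
        also have "\<dots> \<le> K * X" using X by (simp add: mult_ac)
        finally show ?thesis using npos by (simp add: field_simps)
      qed
      finally have "real m * norm (S m) \<le> real m * (p m * (M + K * (real m / real n)))"
        by (simp add: mult_ac)
      then show ?thesis using mpos by simp
    qed
  qed
qed

text \<open>
  The bound for the ratios is split into a constant \<open>B\<close>, which is what contracts, and a correction
  \<open>h\<close> that is controlled only on average.  Two corrections occur: \<open>h m = K * m / n\<close> from
  \<open>growth\<close>, and a constant on an initial segment where a bound valid from some index on may fail.
\<close>
lemma contraction: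
  assumes n: "8 * dp \<le> real n"
    and S: "\<And>m. norm (S m) \<le> p m * (B + h m)"
    and h: "\<And>m. 0 \<le> h m" and B: "0 \<le> B"
    and hs: "summable (\<lambda>m. p m * radius n ^ m * h m)"
  shows "real n * norm (S n) \<le> norm (T n) + 2 * (real n * p n) * norm (G (radius n))
    + (1 - gain) * B * (real n * p n)
    + (\<Sum>m<n. d (n - m) * p m * h m) + dm * (\<Sum>m. p m * radius n ^ m * h m)"
proof -
  define x where "x = radius n"
  have x: "0 \<le> x" "x < 1" using radius_bounds[OF n] by (auto simp: x_def)
  note Fpos = gf_pos[OF x]
  have hs': "summable (\<lambda>m. p m * x ^ m * h m)" using hs by (simp add: x_def)
  define R where "R = (\<Sum>m. S (m + n) * of_real x ^ (m + n))"
  define t where "t = (\<Sum>m. p (m + n) * x ^ (m + n))"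
  define th where "th = (\<Sum>m. p (m + n) * x ^ (m + n) * h (m + n))"
  have t: "t \<le> gf x / 4" using tail_at_radius[OF n] by (simp add: t_def x_def)
  have ts: "summable (\<lambda>m. p (m + n) * x ^ (m + n))"
    using summable_ignore_initial_segment[OF p_summable[OF x]] .
  have ths: "summable (\<lambda>m. p (m + n) * x ^ (m + n) * h (m + n))"
    using summable_ignore_initial_segment[OF hs'] .
  have head: "(\<Sum>m<n. p m * x ^ m) = gf x - t"
    using suminf_split_initial_segment[OF p_summable[OF x], of n] by (simp add: gf_def t_def)
  have S_head: "(\<Sum>m<n. S m * of_real x ^ m) = G x * of_real (gf x) - R"
    using suminf_split_initial_segment[OF sums_summable[OF S_sums[OF x]], of n]
      sums_unique[OF S_sums[OF x]] by (simp add: R_def)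
  have th_le: "th \<le> (\<Sum>m. p m * x ^ m * h m)"
    using suminf_split_initial_segment[OF hs', of n] x h by (simp add: th_def sum_nonneg)
  have R: "norm R \<le> B * t + th"
  proof -
    have "norm R \<le> (\<Sum>m. B * (p (m + n) * x ^ (m + n)) + p (m + n) * x ^ (m + n) * h (m + n))"
      unfolding R_def
    proof (rule norm_suminf_le)
      fix m
      have "norm (S (m + n)) * x ^ (m + n) \<le> p (m + n) * (B + h (m + n)) * x ^ (m + n)"
        using x by (intro mult_right_mono S) auto
      then show "norm (S (m + n) * of_real x ^ (m + n))
          \<le> B * (p (m + n) * x ^ (m + n)) + p (m + n) * x ^ (m + n) * h (m + n)"
        using x by (simp add: norm_mult norm_power algebra_simps)
    qed (intro summable_add summable_mult ts ths)
    also have "\<dots> = B * t + th"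
      by (subst suminf_add[symmetric]) (auto simp: t_def th_def suminf_mult ts ths summable_mult)
    finally show ?thesis .
  qed
  have coef: "0 \<le> d (n - m) - dm * x ^ m" if "m < n" for m
  proof -
    have "dm * x ^ m \<le> dm * 1" using x dm_pos by (intro mult_left_mono power_le_one) auto
    then show ?thesis using d_lower[OF that] by simp
  qed
  \<comment> \<open>The part \<open>m < n\<close> of the small sum \<open>G x * gf x\<close> is split off the recurrence with factor \<open>dm\<close>;
      the remaining coefficients stay nonnegative, so they remain weights when norms are taken.\<close>
  have "of_nat n * S n = T n + (\<Sum>m<n. of_real (d (n - m) - dm * x ^ m) * S m)
      + of_real dm * (\<Sum>m<n. S m * of_real x ^ m)"
    by (simp add: S_rec sum_distrib_left flip: sum.distrib) (simp add: algebra_simps)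
  then have "real n * norm (S n) = norm (T n + (\<Sum>m<n. of_real (d (n - m) - dm * x ^ m) * S m)
      + of_real dm * (G x * of_real (gf x) - R))"
    unfolding S_head by (metis norm_mult norm_of_nat)
  also have "\<dots> \<le> norm (T n) + norm (\<Sum>m<n. of_real (d (n - m) - dm * x ^ m) * S m)
      + dm * (norm (G x) * gf x + norm R)"
  proof -
    have "norm (of_real dm * (G x * of_real (gf x) - R)) \<le> dm * (norm (G x) * gf x + norm R)"
      using dm_pos Fpos norm_triangle_ineq4[of "G x * of_real (gf x)" R]
      by (simp add: norm_mult)
    then show ?thesis
      by (intro order_trans[OF norm_triangle_ineq] add_mono norm_triangle_ineq)
  qed
  also have "norm (\<Sum>m<n. of_real (d (n - m) - dm * x ^ m) * S m)
      \<le> (\<Sum>m<n. (d (n - m) - dm * x ^ m) * (p m * (B + h m)))"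
    using coef S by (intro sum_norm_le) (simp add: norm_mult mult_left_mono del: of_real_diff of_real_mult)
  also have "\<dots> \<le> (\<Sum>m<n. B * (d (n - m) * p m) - B * dm * (p m * x ^ m) + d (n - m) * p m * h m)"
    using x h dm_pos by (intro sum_mono) (simp add: algebra_simps)
  also have "\<dots> = B * (real n * p n) - B * dm * (gf x - t) + (\<Sum>m<n. d (n - m) * p m * h m)"
    by (simp only: sum.distrib sum_subtractf p_rec head flip: sum_distrib_left)
  also have "dm * (norm (G x) * gf x + norm R) \<le> dm * (norm (G x) * gf x + (B * t + (\<Sum>m. p m * x ^ m * h m)))"
    using dm_pos R th_le by (intro mult_left_mono add_left_mono) auto
  also have "norm (T n) + (B * (real n * p n) - B * dm * (gf x - t) + (\<Sum>m<n. d (n - m) * p m * h m)) +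
      dm * (norm (G x) * gf x + (B * t + (\<Sum>m. p m * x ^ m * h m)))
    = norm (T n) + dm * gf x * norm (G x) + B * (real n * p n) + B * dm * (2 * t - gf x)
    + (\<Sum>m<n. d (n - m) * p m * h m) + dm * (\<Sum>m. p m * x ^ m * h m)"
    by (simp add: algebra_simps)
  finally have main: "real n * norm (S n) \<le> norm (T n) + dm * gf x * norm (G x)
    + B * (real n * p n) + B * dm * (2 * t - gf x)
    + (\<Sum>m<n. d (n - m) * p m * h m) + dm * (\<Sum>m. p m * x ^ m * h m)" by simp
  have "dm * gf x * norm (G x) \<le> 2 * (real n * p n) * norm (G x)"
    unfolding x_def by (intro mult_right_mono gf_upper n) auto
  \<comment> \<open>Subtraction removes the weight \<open>gf x - t\<close> below \<open>n\<close> and brings in \<open>t\<close> from the tail.\<close>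
  moreover have "B * dm * (2 * t - gf x) \<le> - (gain * B * (real n * p n))"
  proof -
    have "B * dm * (2 * t - gf x) \<le> B * dm * (- (gf x / 2))"
      using t B dm_pos by (intro mult_left_mono) auto
    also have "\<dots> \<le> - (B * (gain * (real n * p n)))"
      using mult_left_mono[OF gf_lower[OF n] B] by (simp add: x_def mult_ac)
    finally show ?thesis by (simp add: mult_ac)
  qed
  ultimately show ?thesis using main unfolding x_def[symmetric] by (simp add: algebra_simps)
qed

text \<open>
  At an index \<open>k\<close> where the ratio \<open>u\<close> attains its maximum over \<open>{..k}\<close>, the bounds of \<open>growth\<close> and
  \<open>contraction\<close> close up to \<open>u k \<le> const + (1 - gain) * u k\<close>.  Only indices beyond some \<open>N\<close>, where
  \<open>G (radius k)\<close> is already bounded, need this argument.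
\<close>
lemma bounded_ratio:
  assumes G: "(G \<longlongrightarrow> 0) (at_left 1)"
    and T: "(\<lambda>n. norm (T n) / (real n * p n)) \<longlonglongrightarrow> 0"
  shows "\<exists>C. \<forall>n. norm (S n) \<le> C * p n"
proof -
  have T_0: "T 0 = 0" using S_rec[of 0] by simp
  have "Bseq (\<lambda>n. norm (T n) / (real n * p n))"
    using T by (intro convergent_imp_Bseq convergentI)
  then obtain e where "\<forall>n. norm (norm (T n) / (real n * p n)) \<le> e"
    by (rule BseqE)
  then have e: "norm (T n) / (real n * p n) \<le> e" for n by simp
  have e': "norm (T n) \<le> e * (real n * p n)" for n
    using e[of n] p_pos[of n] T_0 by (cases "n = 0") (auto simp: divide_le_eq)
  define K where "K = e * (dp * (1 + dp) / dm)"
  have "0 \<le> e" using e[of 0] by simp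
  then have K: "0 \<le> K" using dm_pos dp_pos by (simp add: K_def)
  have "(\<lambda>n. G (radius n)) \<longlonglongrightarrow> 0" by (rule filterlim_compose[OF G radius_at_left])
  then have "\<forall>\<^sub>F n in sequentially. norm (G (radius n)) < 1"
    using tendstoD[of _ 0 _ 1] by fastforce
  moreover have "\<forall>\<^sub>F n in sequentially. 8 * dp \<le> real n"
    using filterlim_real_sequentially unfolding filterlim_at_top by blast
  ultimately obtain N where N: "\<And>n. n \<ge> N \<Longrightarrow> norm (G (radius n)) < 1 \<and> 8 * dp \<le> real n"
    unfolding eventually_sequentially by (meson max.bounded_iff)
  define u where "u n = norm (S n) / p n" for n
  have u: "norm (S n) = u n * p n" for n using p_pos[of n] by (simp add: u_def)
  define C where "C = Max (insert ((e + 2 + 2 * K) / gain) (u ` {..N}))"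
  have "u n \<le> C" for n
  proof -
    have "Max (u ` {..n}) \<in> u ` {..n}" by (intro Max_in) auto
    then obtain k where k: "k \<le> n" "u k = Max (u ` {..n})"
      unfolding image_iff by fastforce
    have uk: "u m \<le> u k" if "m \<le> n" for m using k that by simp
    have "u k \<le> C"
    proof (cases "k \<le> N")
      case True
      then show ?thesis unfolding C_def by (intro Max_ge) auto
    next
      case False
      then have k8: "8 * dp \<le> real k" and Gk: "norm (G (radius k)) \<le> 1" and kpos: "k \<ge> 1"
        using N[of k] by auto
      have x: "0 \<le> radius k" "radius k < 1" using radius_bounds[OF k8] by auto
      have grow: "norm (S m) \<le> p m * (u k + K * (real m / real k))" for m
        using kpos e' _ K_def
      proof (rule growth)
        fix m assume "m \<le> k"
        then show "norm (S m) \<le> u k * p m" using uk[of m] k(1) by (simp add: u mult_right_mono)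
      qed
      have moment: "p m * radius k ^ m * (K * (real m / real k)) = K / real k * (real m * p m * radius k ^ m)" for m
        by simp
      have "real k * norm (S k) \<le> norm (T k) + 2 * (real k * p k) * norm (G (radius k))
        + (1 - gain) * u k * (real k * p k)
        + (\<Sum>m<k. d (k - m) * p m * (K * (real m / real k)))
        + dm * (\<Sum>m. p m * radius k ^ m * (K * (real m / real k)))"
      proof (rule contraction[OF k8 grow])
        show "summable (\<lambda>m. p m * radius k ^ m * (K * (real m / real k)))"
          unfolding moment by (intro summable_mult gf_first_moment x)
      qed (use K p_pos[of k] in \<open>auto simp: u_def\<close>)
      also have "(\<Sum>m<k. d (k - m) * p m * (K * (real m / real k))) \<le> (\<Sum>m<k. d (k - m) * p m * K)"
        using K d_pos by (intro sum_mono mult_left_mono mult_left_le) (auto simp: less_imp_le)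
      also have "\<dots> = K * (real k * p k)" by (simp add: p_rec sum_distrib_left mult_ac)
      also have "dm * (\<Sum>m. p m * radius k ^ m * (K * (real m / real k))) \<le> K * (real k * p k)"
      proof -
        have "(\<Sum>m. p m * radius k ^ m * (K * (real m / real k))) \<le> K / real k * (real k / 4 * gf (radius k))"
          unfolding moment suminf_mult[OF gf_first_moment(1)[OF x]]
          using K by (intro mult_left_mono moment_at_radius k8) auto
        also have "\<dots> = K / 4 * gf (radius k)" using kpos by simp
        finally have "dm * (\<Sum>m. p m * radius k ^ m * (K * (real m / real k))) \<le> K / 4 * (dm * gf (radius k))"
          using dm_pos by (simp add: mult_ac)
        also have "\<dots> \<le> K / 4 * (2 * (real k * p k))"
          using K by (intro mult_left_mono gf_upper k8) auto
        also have "\<dots> \<le> K * (real k * p k)" using K by simp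
        finally show ?thesis .
      qed
      also have "2 * (real k * p k) * norm (G (radius k)) \<le> 2 * (real k * p k) * 1"
        using Gk by (intro mult_left_mono) auto
      also have "norm (T k) \<le> e * (real k * p k)" by (rule e')
      finally have "(real k * p k) * u k \<le> (real k * p k) * (e + 2 + (1 - gain) * u k + 2 * K)"
        by (simp add: u algebra_simps)
      moreover have "0 < real k * p k" using kpos p_pos by simp
      ultimately have "u k \<le> e + 2 + (1 - gain) * u k + 2 * K" by (simp only: mult_le_cancel_left_pos)
      then have "u k \<le> (e + 2 + 2 * K) / gain" using gain_pos by (simp add: field_simps)
      also have "\<dots> \<le> C" unfolding C_def by (intro Max_ge) auto
      finally show ?thesis .
    qed
    then show ?thesis using uk[of n] by simp
  qed
  then show ?thesis using p_pos by (auto simp: u intro!: exI[of _ C] mult_right_mono)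
qed

text \<open>
  Half of the gain absorbs everything that tends to 0: the inhomogeneous term, \<open>G\<close>, and the
  contribution of the finitely many indices at which only the bound \<open>C\<close> is known.
\<close>
lemma bound_improves:
  assumes G: "(G \<longlongrightarrow> 0) (at_left 1)"
    and T: "(\<lambda>n. norm (T n) / (real n * p n)) \<longlonglongrightarrow> 0"
    and B: "0 < B" "\<forall>\<^sub>F n in sequentially. norm (S n) \<le> B * p n"
    and C: "\<And>n. norm (S n) \<le> C * p n"
  shows "\<forall>\<^sub>F n in sequentially. norm (S n) \<le> (1 - gain / 2) * B * p n"
proof -
  obtain N where N: "\<And>n. n \<ge> N \<Longrightarrow> norm (S n) \<le> B * p n"
    using B(2) by (auto simp: eventually_sequentially)
  define h where "h m = (if m < N then C else 0)" for m
  have C_nonneg: "0 \<le> C" using order_trans[OF norm_ge_zero C[of 0]] by (simp add: p_0)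
  then have h: "0 \<le> h m" for m by (simp add: h_def)
  have S_le: "norm (S m) \<le> p m * (B + h m)" for m
  proof (cases "m < N")
    case True
    have "C * p m \<le> (B + C) * p m" using B by (intro mult_right_mono) auto
    then show ?thesis using True C[of m] by (simp add: h_def mult.commute)
  qed (use N in \<open>simp add: h_def mult.commute\<close>)
  have "(\<lambda>n. G (radius n)) \<longlonglongrightarrow> 0" by (rule filterlim_compose[OF G radius_at_left])
  then have "(\<lambda>n. norm (T n) / (real n * p n) + 2 * norm (G (radius n))
      + (dp + dm) * C * mass N / (real n * p n)) \<longlonglongrightarrow> 0 + 2 * 0 + 0"
    by (intro tendsto_add T const_over_np tendsto_mult tendsto_const tendsto_norm_zero)
  then have "\<forall>\<^sub>F n in sequentially. norm (T n) / (real n * p n) + 2 * norm (G (radius n))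
      + (dp + dm) * C * mass N / (real n * p n) < gain / 2 * B"
    by (rule order_tendstoD) (use gain_pos B in simp)
  moreover have "\<forall>\<^sub>F n in sequentially. 8 * dp \<le> real n"
    using filterlim_real_sequentially unfolding filterlim_at_top by blast
  ultimately show ?thesis using eventually_ge_at_top[of N]
  proof eventually_elim
    case (elim n)
    have x: "0 \<le> radius n" "radius n < 1" using radius_bounds[OF elim(2)] by auto
    have npos: "0 < real n" using elim(2) dp_pos by linarith
    define w where "w = real n * p n"
    have w: "0 < w" using npos p_pos by (simp add: w_def)
    have fin: "p m * radius n ^ m * h m = 0" if "m \<notin> {..<N}" for m using that by (simp add: h_def)
    have "real n * norm (S n) \<le> norm (T n) + 2 * w * norm (G (radius n)) + (1 - gain) * B * w
      + (\<Sum>m<n. d (n - m) * p m * h m) + dm * (\<Sum>m. p m * radius n ^ m * h m)"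
      unfolding w_def using elim(2) S_le h less_imp_le[OF B(1)] summable_finite[of "{..<N}", OF _ fin]
      by (rule contraction) auto
    also have "(\<Sum>m<n. d (n - m) * p m * h m) \<le> dp * C * mass N"
    proof -
      have "(\<Sum>m<n. d (n - m) * p m * h m) = (\<Sum>m<N. d (n - m) * p m * h m)"
        using elim(3) by (intro sum.mono_neutral_right) (auto simp: h_def)
      also have "\<dots> \<le> (\<Sum>m<N. dp * p m * C)"
        using elim(3) C_nonneg by (intro sum_mono) (auto simp: h_def intro!: mult_right_mono d_upper)
      finally show ?thesis by (simp add: mass_def sum_distrib_left mult_ac)
    qed
    also have "dm * (\<Sum>m. p m * radius n ^ m * h m) \<le> dm * (C * mass N)"
    proof -
      have "(\<Sum>m. p m * radius n ^ m * h m) = (\<Sum>m<N. p m * radius n ^ m * h m)"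
        by (rule suminf_finite[of "{..<N}", OF _ fin]) auto
      also have "\<dots> \<le> (\<Sum>m<N. p m * C)"
        using x C_nonneg by (intro sum_mono) (auto simp: h_def intro!: mult_right_mono mult_left_le power_le_one)
      finally have "(\<Sum>m. p m * radius n ^ m * h m) \<le> C * mass N"
        by (simp add: mass_def sum_distrib_left mult_ac)
      then show ?thesis using dm_pos by (intro mult_left_mono) auto
    qed
    finally have "real n * norm (S n) \<le> norm (T n) + 2 * w * norm (G (radius n))
        + (1 - gain) * B * w + dp * C * mass N + dm * (C * mass N)" by simp
    also have "\<dots> = w * (norm (T n) / w + 2 * norm (G (radius n))
        + (dp + dm) * C * mass N / w) + (1 - gain) * B * w"
      using w by (simp add: distrib_left) (simp add: algebra_simps)
    also have "\<dots> \<le> w * (gain / 2 * B) + (1 - gain) * B * w"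
      using elim(1) w by (intro add_right_mono mult_left_mono) (auto simp: w_def)
    also have "\<dots> = real n * ((1 - gain / 2) * B * p n)"
      by (simp add: w_def algebra_simps)
    finally show ?case using npos by simp
  qed
qed

lemma gain_le_1: "gain \<le> 1"
proof -
  have "dm \<le> dp" using d_bounds[of 1] by simp
  moreover have "exp (- 8 * dp) \<le> 1" using dp_pos by simp
  ultimately have "dm * exp (- 8 * dp) \<le> dp * 1"
    using dm_pos dp_pos by (intro mult_mono) auto
  then show ?thesis using dp_pos by (simp add: gain_def)
qed

lemma tauberian:
  assumes G: "(G \<longlongrightarrow> 0) (at_left 1)"
    and T: "(\<lambda>n. norm (T n) / (real n * p n)) \<longlonglongrightarrow> 0"
  shows "(\<lambda>n. norm (S n) / p n) \<longlonglongrightarrow> 0"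
proof -
  obtain C' where C': "\<And>n. norm (S n) \<le> C' * p n" using bounded_ratio[OF G T] by blast
  define C where "C = max C' 1"
  have C: "norm (S n) \<le> C * p n" for n
    using C'[of n] mult_right_mono[of C' C "p n"] by (simp add: C_def)
  have Cpos: "0 < C" by (simp add: C_def)
  have gains: "0 < 1 - gain / 2" "1 - gain / 2 < 1" using gain_pos gain_le_1 by auto
  \<comment> \<open>The factor stays below 1, so finitely many improvements bring the bound under any \<open>\<epsilon>\<close>.\<close>
  have iter: "\<forall>\<^sub>F n in sequentially. norm (S n) \<le> (1 - gain / 2) ^ k * C * p n" for k
  proof (induction k)
    case (Suc k)
    have "\<forall>\<^sub>F n in sequentially. norm (S n) \<le> (1 - gain / 2) * ((1 - gain / 2) ^ k * C) * p n"
      using gains Cpos by (intro bound_improves[OF G T _ Suc C]) simp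
    then show ?case by (simp add: mult_ac)
  qed (use C in simp)
  show ?thesis
  proof (rule tendstoI)
    fix \<epsilon> :: real assume "0 < \<epsilon>"
    have "(\<lambda>k. (1 - gain / 2) ^ k * C) \<longlonglongrightarrow> 0 * C"
      using gains by (intro tendsto_mult LIMSEQ_power_zero tendsto_const) auto
    then have "\<forall>\<^sub>F k in sequentially. (1 - gain / 2) ^ k * C < \<epsilon>"
      by (rule order_tendstoD) (use \<open>0 < \<epsilon>\<close> in simp)
    then obtain k where k: "(1 - gain / 2) ^ k * C < \<epsilon>"
      using eventually_happens trivial_limit_sequentially by blast
    show "\<forall>\<^sub>F n in sequentially. dist (norm (S n) / p n) 0 < \<epsilon>"
      using iter[of k]
    proof eventually_elim
      case (elim n)
      then have "norm (S n) / p n \<le> (1 - gain / 2) ^ k * C"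
        using p_pos[of n] by (simp add: divide_le_eq)
      then show ?case using k by simp
    qed
  qed
qed

lemma ratio_splitting:
  assumes u: "(\<lambda>n. norm (S n) / p n) \<longlonglongrightarrow> 0" and "0 < \<epsilon>"
  obtains C N where "0 \<le> C"
    and "\<And>m. norm (S m) \<le> p m * (\<epsilon> + (if m < N then C else 0))"
proof -
  have "\<forall>\<^sub>F n in sequentially. norm (S n) / p n < \<epsilon>"
    by (rule order_tendstoD(2)[OF u \<open>0 < \<epsilon>\<close>])
  then obtain N where N: "\<And>n. n \<ge> N \<Longrightarrow> norm (S n) / p n < \<epsilon>"
    by (auto simp: eventually_sequentially)
  define C where "C = (\<Sum>m<N. norm (S m) / p m)"
  show ?thesis
  proof
    show "0 \<le> C" by (simp add: C_def sum_nonneg)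
    show "norm (S m) \<le> p m * (\<epsilon> + (if m < N then C else 0))" for m
    proof -
      have "norm (S m) / p m \<le> \<epsilon> + (if m < N then C else 0)"
      proof (cases "m < N")
        case True
        have "norm (S m) / p m \<le> C"
          unfolding C_def using True by (intro member_le_sum) auto
        then show ?thesis using True \<open>0 < \<epsilon>\<close> by simp
      qed (use N[of m] in auto)
      then show ?thesis using p_pos[of m] by (simp add: divide_le_eq mult.commute)
    qed
  qed
qed

text \<open>The weight \<open>mass N / gf x\<close> of an initial segment vanishes because \<open>gf\<close> is unbounded near 1.\<close>
lemma abelian_G:
  assumes u: "(\<lambda>n. norm (S n) / p n) \<longlonglongrightarrow> 0"
  shows "(G \<longlongrightarrow> 0) (at_left 1)"
proof (rule tendstoI)
  fix \<epsilon> :: real assume "0 < \<epsilon>"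
  then have "0 < \<epsilon> / 2" by simp
  from ratio_splitting[OF u this] obtain C N where C: "0 \<le> C"
    and S: "\<And>m. norm (S m) \<le> p m * (\<epsilon> / 2 + (if m < N then C else 0))" by blast
  have "((\<lambda>x. C * mass N / gf x) \<longlongrightarrow> 0) (at_left 1)"
    by (rule real_tendsto_divide_at_top[OF tendsto_const gf_at_top])
  then have "\<forall>\<^sub>F x in at_left 1. C * mass N / gf x < \<epsilon> / 2"
    by (rule order_tendstoD) (use \<open>0 < \<epsilon>\<close> in simp)
  moreover have "\<forall>\<^sub>F x in at_left (1::real). x \<in> {0<..<1}"
    by (rule eventually_at_left_real) simp
  ultimately show "\<forall>\<^sub>F x in at_left 1. dist (G x) 0 < \<epsilon>"
  proof eventually_elim
    case (elim x)
    then have x: "0 \<le> x" "x < 1" by auto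
    define h where "h m = p m * x ^ m * (if m < N then C else 0)" for m
    have h0: "h m = 0" if "m \<notin> {..<N}" for m using that by (simp add: h_def)
    have hs: "summable h" by (rule summable_finite[of "{..<N}", OF _ h0]) auto
    have "norm (G x) * gf x = norm (G x * of_real (gf x))"
      using gf_pos[OF x] by (simp add: norm_mult)
    also have "\<dots> = norm (\<Sum>m. S m * of_real x ^ m)"
      using sums_unique[OF S_sums[OF x]] by simp
    also have "\<dots> \<le> (\<Sum>m. \<epsilon> / 2 * (p m * x ^ m) + h m)"
    proof (rule norm_suminf_le)
      fix m
      have "norm (S m) * x ^ m \<le> p m * (\<epsilon> / 2 + (if m < N then C else 0)) * x ^ m"
        using x by (intro mult_right_mono S) auto
      then show "norm (S m * of_real x ^ m) \<le> \<epsilon> / 2 * (p m * x ^ m) + h m"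
        using x by (simp add: norm_mult norm_power h_def algebra_simps)
    qed (intro summable_add summable_mult p_summable x hs)
    also have "\<dots> = \<epsilon> / 2 * gf x + suminf h"
      by (subst suminf_add[symmetric])
        (auto simp: gf_def suminf_mult p_summable[OF x] hs simp del: times_divide_eq_left intro!: summable_mult)
    also have "suminf h = (\<Sum>m<N. h m)"
      by (rule suminf_finite[of "{..<N}", OF _ h0]) auto
    also have "\<dots> \<le> (\<Sum>m<N. p m * C)"
      using x C by (intro sum_mono) (auto simp: h_def intro!: mult_right_mono mult_left_le power_le_one)
    also have "\<dots> = C * mass N" by (simp add: mass_def sum_distrib_left mult_ac)
    also have "\<epsilon> / 2 * gf x + C * mass N < \<epsilon> * gf x"
      using elim(1) gf_pos[OF x] by (simp add: field_simps)
    finally show ?case using gf_pos[OF x] by simp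
  qed
qed

text \<open>
  The recurrence expresses \<open>T n / (n * p n)\<close> as \<open>S n / p n\<close> minus an average of the earlier ratios, in which
  each initial segment has vanishing weight because \<open>n * p n\<close> tends to infinity.
\<close>
lemma abelian_T:
  assumes u: "(\<lambda>n. norm (S n) / p n) \<longlonglongrightarrow> 0"
  shows "(\<lambda>n. norm (T n) / (real n * p n)) \<longlonglongrightarrow> 0"
proof (rule tendstoI)
  fix \<epsilon> :: real assume "0 < \<epsilon>"
  then have "0 < \<epsilon> / 3" by simp
  from ratio_splitting[OF u this] obtain C N where C: "0 \<le> C"
    and S: "\<And>m. norm (S m) \<le> p m * (\<epsilon> / 3 + (if m < N then C else 0))" by blast
  have "\<forall>\<^sub>F n in sequentially. dp * C * mass N / (real n * p n) < \<epsilon> / 3"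
    by (rule order_tendstoD(2)[OF const_over_np]) fact
  then show "\<forall>\<^sub>F n in sequentially. dist (norm (T n) / (real n * p n)) 0 < \<epsilon>"
    using eventually_ge_at_top[of N] eventually_gt_at_top[of 0]
  proof eventually_elim
    case (elim n)
    have w: "0 < real n * p n" using elim p_pos by simp
    have "norm (T n) = norm (of_nat n * S n - (\<Sum>m<n. of_real (d (n - m)) * S m))"
      by (simp add: S_rec)
    also have "\<dots> \<le> real n * norm (S n) + (\<Sum>m<n. norm (of_real (d (n - m)) * S m))"
      by (intro order_trans[OF norm_triangle_ineq4] add_mono norm_sum) (simp add: norm_mult)
    also have "\<dots> \<le> real n * (p n * (\<epsilon> / 3))
        + (\<Sum>m<n. \<epsilon> / 3 * (d (n - m) * p m) + d (n - m) * p m * (if m < N then C else 0))"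
    proof (intro add_mono mult_left_mono sum_mono)
      fix m assume "m \<in> {..<n}"
      then have "d (n - m) * norm (S m) \<le> d (n - m) * (p m * (\<epsilon> / 3 + (if m < N then C else 0)))"
        using d_pos by (intro mult_left_mono S) (auto simp: less_imp_le)
      then show "norm (of_real (d (n - m)) * S m)
          \<le> \<epsilon> / 3 * (d (n - m) * p m) + d (n - m) * p m * (if m < N then C else 0)"
        using \<open>m \<in> {..<n}\<close> d_pos[of m n] by (simp add: norm_mult algebra_simps split: if_splits)
    qed (use S[of n] elim in auto)
    also have "\<dots> = 2 * (\<epsilon> / 3) * (real n * p n)
        + (\<Sum>m<n. d (n - m) * p m * (if m < N then C else 0))"
      unfolding sum.distrib sum_distrib_left[symmetric] p_rec[symmetric] by (simp add: algebra_simps)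
    also have "(\<Sum>m<n. d (n - m) * p m * (if m < N then C else 0))
        = (\<Sum>m<N. d (n - m) * p m * (if m < N then C else 0))"
      using elim by (intro sum.mono_neutral_right) auto
    also have "\<dots> \<le> (\<Sum>m<N. dp * p m * C)"
      using elim C by (intro sum_mono) (auto intro!: mult_right_mono d_upper)
    also have "\<dots> = dp * C * mass N" by (simp add: mass_def sum_distrib_left mult_ac)
    also have "2 * (\<epsilon> / 3) * (real n * p n) + dp * C * mass N < \<epsilon> * (real n * p n)"
      using elim(1) w by (simp add: divide_less_eq)
    finally show ?case using w by (simp add: divide_less_eq)
  qed
qed

lemma ratio_vanishes_iff:
  "(\<lambda>n. norm (S n) / p n) \<longlonglongrightarrow> 0 \<longleftrightarrow>
    (G \<longlongrightarrow> 0) (at_left 1) \<and> (\<lambda>n. norm (T n) / (real n * p n)) \<longlonglongrightarrow> 0"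
  using tauberian abelian_G abelian_T by blast

end

section \<open>The two conditions for Voronoi sums\<close>

theorem theorem2:
  fixes a :: "nat \<Rightarrow> complex" and g :: "complex \<Rightarrow> complex"
    and d p :: "nat \<Rightarrow> real" and d_minus d_plus :: real and A :: complex
  assumes g_analytic: "g analytic_on ball 0 1"
    and g_series: "\<And>z. norm z < 1 \<Longrightarrow> (\<lambda>n. a n * z ^ n) sums g z"
    and d_minus_pos: "0 < d_minus"
    and d_plus_pos: "0 < d_plus"
    and d_bounds: "\<And>k. k \<ge> 1 \<Longrightarrow> d_minus \<le> d k \<and> d k \<le> d_plus"
    and p_series: "\<And>z :: complex. norm z < 1 \<Longrightarrow>
      (\<lambda>j. complex_of_real (p j) * z ^ j) sums
        exp (\<Sum>k. complex_of_real (d (Suc k) / real (Suc k)) * z ^ Suc k)"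
  shows "((\<lambda>n. (1 / complex_of_real (p n)) * (\<Sum>k\<le>n. a k * complex_of_real (p (n - k))))
            \<longlonglongrightarrow> A) \<longleftrightarrow>
         ((\<lambda>x :: real. g (complex_of_real x)) \<longlongrightarrow> A) (at_left 1) \<and>
         (\<lambda>n. \<Sum>k\<le>n. a k * of_nat k * complex_of_real (p (n - k)))
            \<in> o(\<lambda>n. complex_of_real (real n * p n))"
proof -
  \<comment> \<open>The value \<open>d 0\<close> is unconstrained; with 0 in its place the bound on the coefficients is uniform.\<close>
  define c where "c k = (if k = 0 then 0 else complex_of_real (d k))" for k
  define D where "D = Abs_fps (\<lambda>k. if k = 0 then 0 else c k)"
  define pf where "pf = Abs_fps (\<lambda>j. complex_of_real (p j))"
  define sf where "sf = (Abs_fps a - fps_const A) * pf"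
  define tf where "tf = fps_X * fps_deriv (Abs_fps a) * pf"
  define S where "S n = (\<Sum>k\<le>n. a k * of_real (p (n - k))) - A * of_real (p n)" for n
  define T where "T n = (\<Sum>k\<le>n. a k * of_nat k * of_real (p (n - k)))" for n
  define G where "G x = g (of_real x) - A" for x :: real

  have c_bound: "norm (c k) \<le> d_plus" for k
    using d_bounds[of k] d_minus_pos d_plus_pos by (cases "k = 0") (auto simp: c_def)
  have pf_euler: "fps_X * fps_deriv pf = 0 + pf * D"
    unfolding pf_def D_def
    using exp_series_euler[OF c_bound, of "\<lambda>j. complex_of_real (p j)"] p_series
    by (simp add: c_def)
  have sf_euler: "fps_X * fps_deriv sf = tf + sf * D"
  proof -
    have "fps_X * fps_deriv sf = tf + (Abs_fps a - fps_const A) * (fps_X * fps_deriv pf)"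
      by (simp add: sf_def tf_def algebra_simps)
    also have "\<dots> = tf + sf * D"
      by (simp add: pf_euler sf_def mult_ac)
    finally show ?thesis .
  qed
  have sf_nth: "fps_nth sf n = S n" for n
    by (simp add: sf_def S_def pf_def left_diff_distrib fps_mult_nth[of "Abs_fps a"] atMost_atLeast0)
  have tf_nth: "fps_nth tf n = T n" for n
  proof -
    have "fps_nth (fps_X * fps_deriv (Abs_fps a)) k = a k * of_nat k" for k
      by (cases k) (simp_all add: mult.commute)
    then show ?thesis
      by (simp add: tf_def T_def pf_def fps_mult_nth[of "fps_X * _"] atMost_atLeast0)
  qed
  have p_rec: "real n * p n = (\<Sum>m<n. d (n - m) * p m)" for n
  proof -
    have "of_nat n * complex_of_real (p n) = (\<Sum>m<n. c (n - m) * of_real (p m))"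
      using fps_euler_operator_nth[OF pf_euler[unfolded D_def], of n] by (simp add: pf_def)
    also have "\<dots> = of_real (\<Sum>m<n. d (n - m) * p m)"
      by (simp add: c_def)
    finally have "complex_of_real (real n * p n) = of_real (\<Sum>m<n. d (n - m) * p m)" by simp
    then show ?thesis by (simp only: of_real_eq_iff)
  qed
  have S_rec: "of_nat n * S n = T n + (\<Sum>m<n. of_real (d (n - m)) * S m)" for n
    using fps_euler_operator_nth[OF sf_euler[unfolded D_def], of n]
    by (simp add: sf_nth tf_nth c_def)
  \<comment> \<open>Convergence at the larger point \<open>(x + 1) / 2\<close> gives absolute convergence at \<open>x\<close>.\<close>
  have p_norm_summable: "summable (\<lambda>n. norm (complex_of_real (p n) * of_real x ^ n))"
    if "0 \<le> x" "x < 1" for x :: real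
  proof (rule powser_insidea)
    show "summable (\<lambda>n. complex_of_real (p n) * of_real ((x + 1) / 2) ^ n)"
      by (rule sums_summable[OF p_series]) (use that in \<open>simp del: of_real_add\<close>)
    show "norm (complex_of_real x) < norm (complex_of_real ((x + 1) / 2))"
      using that by (simp del: of_real_add of_real_divide)
  qed
  have p_summable: "summable (\<lambda>n. p n * x ^ n)" if "0 \<le> x" "x < 1" for x :: real
    using summable_norm_cancel[OF p_norm_summable[OF that]]
    by (simp flip: of_real_power of_real_mult add: summable_of_real_iff)
  have p_0: "p 0 = 1"
    using sums_unique2[OF p_series[of 0] powser_sums_zero[of "\<lambda>j. complex_of_real (p j)"]] by simp

  interpret bounded_log_derivative d p d_minus d_plus
    by unfold_locales (fact d_minus_pos d_bounds p_0 p_rec p_summable)+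
  interpret weighted_recurrence d p d_minus d_plus S T G
  proof
    show "of_nat n * S n = T n + (\<Sum>m<n. of_real (d (n - m)) * S m)" for n by (rule S_rec)
    fix x :: real assume x: "0 \<le> x" "x < 1"
    have gf: "(\<lambda>n. complex_of_real (p n) * of_real x ^ n) sums of_real (gf x)"
      using sums_of_real[OF summable_sums[OF p_summable[OF x]], where 'a = complex]
      by (simp add: gf_def)
    have "summable (\<lambda>n. norm (a n * of_real x ^ n))"
    proof (rule powser_insidea)
      show "summable (\<lambda>n. a n * of_real ((x + 1) / 2) ^ n)"
        by (rule sums_summable[OF g_series]) (use x in \<open>simp del: of_real_add\<close>)
      show "norm (complex_of_real x) < norm (complex_of_real ((x + 1) / 2))"
        using x by (simp del: of_real_add of_real_divide)
    qed
    from Cauchy_product_sums[OF this p_norm_summable[OF x]]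
    have "(\<lambda>n. \<Sum>k\<le>n. a k * of_real x ^ k * (of_real (p (n - k)) * of_real x ^ (n - k)))
        sums (g (of_real x) * of_real (gf x))"
      using sums_unique[OF g_series[of "of_real x"]] sums_unique[OF gf] x by simp
    moreover have "(\<Sum>k\<le>n. a k * of_real x ^ k * (of_real (p (n - k)) * of_real x ^ (n - k)))
        = (\<Sum>k\<le>n. a k * of_real (p (n - k))) * of_real x ^ n" for n
      unfolding sum_distrib_right
    proof (rule sum.cong)
      fix k assume "k \<in> {..n}"
      then have "complex_of_real x ^ n = of_real x ^ k * of_real x ^ (n - k)"
        by (simp flip: power_add)
      then show "a k * of_real x ^ k * (of_real (p (n - k)) * of_real x ^ (n - k))
          = a k * of_real (p (n - k)) * of_real x ^ n" by simp
    qed simp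
    ultimately have "(\<lambda>n. (\<Sum>k\<le>n. a k * of_real (p (n - k))) * of_real x ^ n
        - A * (of_real (p n) * of_real x ^ n)) sums (g (of_real x) * of_real (gf x) - A * of_real (gf x))"
      by (intro sums_diff sums_mult gf) simp
    then show "(\<lambda>n. S n * of_real x ^ n) sums (G x * of_real (gf x))"
      by (simp add: S_def G_def left_diff_distrib mult.assoc)
  qed

  have "((\<lambda>n. (1 / complex_of_real (p n)) * (\<Sum>k\<le>n. a k * complex_of_real (p (n - k)))) \<longlonglongrightarrow> A)
      \<longleftrightarrow> (\<lambda>n. S n / of_real (p n)) \<longlonglongrightarrow> 0"
  proof -
    have "(1 / complex_of_real (p n)) * (\<Sum>k\<le>n. a k * complex_of_real (p (n - k))) - A = S n / of_real (p n)" for n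
      using p_pos[of n] by (simp add: S_def diff_divide_distrib)
    then show ?thesis
      using LIM_zero_iff[of "\<lambda>n. (1 / complex_of_real (p n)) * (\<Sum>k\<le>n. a k * complex_of_real (p (n - k)))" A sequentially]
      by simp
  qed
  also have "\<dots> \<longleftrightarrow> (\<lambda>n. norm (S n) / p n) \<longlonglongrightarrow> 0"
    using tendsto_norm_zero_iff[of "\<lambda>n. S n / of_real (p n)" sequentially]
    by (simp add: norm_divide)
  also note ratio_vanishes_iff
  also have "(G \<longlongrightarrow> 0) (at_left 1) \<longleftrightarrow> ((\<lambda>x :: real. g (complex_of_real x)) \<longlongrightarrow> A) (at_left 1)"
    unfolding G_def by (rule LIM_zero_iff)
  also have "(\<lambda>n. norm (T n) / (real n * p n)) \<longlonglongrightarrow> 0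
      \<longleftrightarrow> (\<lambda>n. T n / of_real (real n * p n)) \<longlonglongrightarrow> 0"
    using tendsto_norm_zero_iff[of "\<lambda>n. T n / of_real (real n * p n)" sequentially]
    by (simp add: norm_divide norm_mult)
  also have "\<dots> \<longleftrightarrow> T \<in> o(\<lambda>n. complex_of_real (real n * p n))"
  proof
    assume "(\<lambda>n. T n / of_real (real n * p n)) \<longlonglongrightarrow> 0"
    moreover have "\<forall>\<^sub>F n in sequentially. complex_of_real (real n * p n) \<noteq> 0"
      using eventually_gt_at_top[of "0::nat"] by eventually_elim (use p_pos in \<open>simp add: less_imp_neq[symmetric]\<close>)
    ultimately show "T \<in> o(\<lambda>n. complex_of_real (real n * p n))" by (rule smalloI_tendsto)
  qed (rule smalloD_tendsto)
  finally show ?thesis unfolding T_def .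
qed

end
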